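(* Let $p,q\in\mathbb{Z}$ with $\min\{p+q+1,\,p-q\}\geq 0$. Then \[ \frac{4^{p+2}}{\sqrt{2}\,\pi}=\sum_{k=0}^{\infty}\frac{(\frac{3}{2})_{k+2p}(\frac{3}{2})_{k+2q}(-\frac{1}{2})_{k-2q}} {k!\,(k+p+q+1)!\,(k+p-q)!}\cdot\frac{6k+4p+3}{(-8)^k}. \]
   Context: For a complex number $x$ and an integer $n$ (possibly negative), the shifted factorial is defined by $(x)_n=\Gamma(x+n)/\Gamma(x)$, where $\Gamma$ is the Gamma function. *)

theory Defs
  imports "HOL-Analysis.Analysis"
begin

(* The library's pochhammer only takes natural-number indices. The value of the quotient
   is the intended one whenever neither x nor x + n is a non-positive integer: there
   the library sets Gamma to 0. *)
definition shifted_fact :: "complex \<Rightarrow> int \<Rightarrow> complex" where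
  "shifted_fact x n = Gamma (x + of_int n) / Gamma x"

end

theory Submission
  imports Defs
begin

text \<open>
  With $a = p + 3/4$ and $b = q + 3/4$ the series is, up to a factor independent of $k$, the limit
  $n \to \infty$ of the terminating Gessel-Stanton sum
  $$ {}_5F_4(2a, 2b, 1-2b, 1+2a/3, -n;\ a-b+1, a+b+1/2, 2a/3, 1+2a+2n;\ 1/4)
     = (a+1/2)_n (a+1)_n / ((a+b+1/2)_n (a-b+1)_n), $$
  because $(-n)_k / (1+2a+2n)_k \to (-1/2)^k$. The terminating sum follows by induction on $n$ from
  a WZ certificate, and Tannery's theorem justifies the limit under the sum. The duplication and
  reflection formulas for the Gamma function then evaluate the constant.
\<close>

section \<open>Summand and WZ certificate\<close>

text \<open>The factors of the 5F4 summand that do not involve \<open>n\<close>; they are common to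
  the recurrence in \<open>n\<close> and stay fixed in the limit.\<close>

definition gs_coeff :: "complex \<Rightarrow> complex \<Rightarrow> nat \<Rightarrow> complex" where
  "gs_coeff a b k = pochhammer (2*a) k * pochhammer (2*b) k * pochhammer (1 - 2*b) k
     / (fact k * pochhammer (a - b + 1) k * pochhammer (a + b + 1/2) k)"

text \<open>The factor $2a + 3k$ is $2a\,(1+2a/3)_k / (2a/3)_k$, so that $a = 0$ needs no exception.\<close>

definition gs_term :: "complex \<Rightarrow> complex \<Rightarrow> nat \<Rightarrow> nat \<Rightarrow> complex" where
  "gs_term a b n k = gs_coeff a b k * (2*a + 3 * of_nat k)
     * (pochhammer (- of_nat n) k / pochhammer (2*a + 2 * of_nat n + 1) k) / 4 ^ k"

text \<open>
  The usual rational certificate has a factor $1/(n + 1 - k)$, which is singular at $k = n + 1$.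
  This is the certificate shifted by one in $k$ and multiplied by its $F$; it has no such pole.
\<close>

definition gs_cert :: "complex \<Rightarrow> complex \<Rightarrow> nat \<Rightarrow> nat \<Rightarrow> complex" where
  "gs_cert a b n k = gs_coeff a b k
     * ((2*a + of_nat k) * (2*b + of_nat k) * (1 - 2*b + of_nat k))
     * (pochhammer (- of_nat n) k / pochhammer (2*a + 2 * of_nat n + 1) (k + 2)) / 4 ^ k"

lemma gs_coeff_Suc:
  "gs_coeff a b (Suc k) = gs_coeff a b k
     * ((2*a + of_nat k) * (2*b + of_nat k) * (1 - 2*b + of_nat k))
     / (of_nat (Suc k) * ((a - b + 1 + of_nat k) * (a + b + 1/2 + of_nat k)))"
  by (simp add: gs_coeff_def pochhammer_Suc mult_ac)

section \<open>Nonvanishing and shifts of Pochhammer symbols\<close>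

lemma add_of_nat_nonzero:
  fixes z :: complex
  assumes "z \<notin> \<int>\<^sub>\<le>\<^sub>0"
  shows "z + of_nat k \<noteq> 0"
  using assms plus_of_nat_eq_0_imp by blast

lemma pochhammer_nonzero:
  fixes z :: complex
  assumes "z \<notin> \<int>\<^sub>\<le>\<^sub>0"
  shows "pochhammer z k \<noteq> 0"
  using assms pochhammer_eq_0_imp_nonpos_Int by blast

lemma Re_pos_not_nonpos_Int:
  fixes z :: complex
  assumes "Re z > 0"
  shows "z \<notin> \<int>\<^sub>\<le>\<^sub>0"
  using assms by (auto elim!: nonpos_Ints_cases)

text \<open>Both sides are (c)_{k+2}, split at either end. With c = 2a + 2n + 1 this links the
  denominators for n and n + 1.\<close>

lemma pochhammer_add2:
  fixes c :: complex
  shows "c * (c + 1) * pochhammer (c + 2) k = pochhammer c k * ((c + of_nat k) * (c + of_nat k + 1))"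
proof -
  have "pochhammer c (2 + k) = pochhammer c 2 * pochhammer (c + 2) k"
    using pochhammer_product'[of c 2 k] by simp
  moreover have "pochhammer c (k + 2) = pochhammer c k * ((c + of_nat k) * (c + of_nat k + 1))"
    by (simp add: pochhammer_Suc add_ac mult_ac)
  ultimately show ?thesis
    by (simp add: eval_nat_numeral pochhammer_Suc add_ac mult_ac)
qed

section \<open>The WZ recurrence and the terminating sum\<close>

text \<open>What remains of the WZ equation between the indices \<open>k\<close> and
  \<open>k + 1\<close> after the common hypergeometric factor is divided out. It is a polynomial
  identity, so expansion proves it.\<close>

lemma gs_WZ_polynomial:
  fixes a b n k :: complex
  shows "- (2*a + 3*k + 3) * (4 * (n + 1) * ((n + a + b + 1/2) * (n + a - b + 1))
            + (k - n) * (2*a + 2*n + 2 + k) * (2*a + 2*n + 3 + k))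
         = (2*a + k + 1) * (2*b + k + 1) * (2 - 2*b + k) * (k - n)
            - 4 * (k + 1) * (a - b + 1 + k) * (a + b + 1/2 + k) * (2*a + 2*n + 3 + k)"
  by (simp add: algebra_simps add_divide_distrib power2_eq_square diff_divide_distrib)

text \<open>\<open>E n / D n\<close> is the ratio of consecutive closed forms. The k-th difference
  on the left is \<open>E n\<close> times the certificate at k minus that at k - 1, so the sum
  telescopes; k = 0 contributes the certificate alone. \<open>Re a > -1/2\<close> keeps every (2a +
  2n + 1)_k nonzero.\<close>

lemma gs_WZ_sum:
  assumes a: "Re a > -1/2" and ab: "a - b + 1 \<notin> \<int>\<^sub>\<le>\<^sub>0" "a + b + 1/2 \<notin> \<int>\<^sub>\<le>\<^sub>0"
  defines "D \<equiv> \<lambda>n. (a + b + 1/2 + of_nat n) * (a - b + 1 + of_nat n)"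
  defines "E \<equiv> \<lambda>n. (a + 1/2 + of_nat n) * (a + 1 + of_nat n)"
  shows "D n * (\<Sum>k\<le>N. gs_term a b (Suc n) k) - E n * (\<Sum>k\<le>N. gs_term a b n k)
           = E n * gs_cert a b n N"
proof (induction N)
  case 0
  have "(2*a + 2 * of_nat n + 1) * (2*a + 2 * of_nat n + 2) = 4 * E n"
    by (simp add: E_def algebra_simps)
  moreover have "2*a + 2 * of_nat n + 1 \<noteq> 0" "2*a + 2 * of_nat n + 2 \<noteq> 0"
    using a by (auto simp: complex_eq_iff)
  ultimately have E: "E n \<noteq> 0" and P: "pochhammer (2*a + 2 * of_nat n + 1) 2 = 4 * E n"
    by (auto simp: eval_nat_numeral pochhammer_Suc add_ac)
  \<comment> \<open>Here \<open>a\<close> and \<open>n\<close> cancel; multiplied by 2a, this is the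
    boundary value \<open>E n * gs_cert a b n 0\<close>.\<close>
  have "D n - E n = b/2 - b * b"
    by (simp add: D_def E_def algebra_simps)
  moreover from this have "2*a * (D n - E n) = 2*a * (b/2 - b*b)" by simp
  moreover have "gs_cert a b n 0 = 2*a * (2*b) * (1 - 2*b) / (4 * E n)"
    using P by (simp add: gs_cert_def gs_coeff_def numeral_2_eq_2)
  hence "E n * gs_cert a b n 0 = 2*a * (2*b) * (1 - 2*b) / 4"
    using E by simp
  hence "E n * gs_cert a b n 0 = 2*a * (b/2 - b*b)"
    by (simp add: algebra_simps diff_divide_distrib)
  ultimately have "(D n - E n) * (2*a) = E n * gs_cert a b n 0"
    by (simp only: mult.commute)
  thus ?case
    by (simp add: gs_term_def gs_coeff_def left_diff_distrib)
next
  case (Suc N)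
  define c where "c = 2*a + 2 * of_nat n + 1"
  define k where "k = (of_nat N :: complex)"
  define m where "m = (of_nat n :: complex)"
  define A where "A = a - b + 1 + k"
  define B where "B = a + b + 1/2 + k"
  define w where "w = pochhammer c N"
  define v where "v = pochhammer (- m) N"
  define T where "T = (2*a + k) * (2*b + k) * (1 - 2*b + k)"
  define T' where "T' = (2*a + k + 1) * (2*b + k + 1) * (2 - 2*b + k)"
  \<comment> \<open>\<open>K\<close> is common to all four terms of the recurrence: \<open>T\<close>
    is the numerator both of the certificate at \<open>N\<close> and of the step of
    \<open>gs_coeff\<close> from \<open>N\<close> to \<open>N + 1\<close>.\<close>
  define K where "K = gs_coeff a b N / 4 ^ N * v / w * T"
  have c0: "c + of_nat j \<noteq> 0" for j
    by (rule add_of_nat_nonzero, rule Re_pos_not_nonpos_Int) (use a in \<open>simp add: c_def\<close>)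
  have nz: "c \<noteq> 0" "c + 1 \<noteq> 0" "c + k \<noteq> 0" "c + k + 1 \<noteq> 0" "c + k + 2 \<noteq> 0"
    using c0[of 0] c0[of 1] c0[of N] c0[of "N+1"] c0[of "N+2"] by (simp_all add: k_def add_ac)
  have w0: "w \<noteq> 0" unfolding w_def
    by (rule pochhammer_nonzero, rule Re_pos_not_nonpos_Int) (use a in \<open>simp add: c_def\<close>)
  have A0: "A \<noteq> 0" and B0: "B \<noteq> 0"
    using add_of_nat_nonzero[OF ab(1), of N] add_of_nat_nonzero[OF ab(2), of N]
    by (simp_all add: A_def B_def k_def)
  have k0: "k + 1 \<noteq> 0" unfolding k_def by (metis of_nat_Suc of_nat_eq_0_iff add.commute nat.distinct(2))
  have cc: "c * (c + 1) = 4 * E n" by (simp add: c_def E_def algebra_simps)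
  have "pochhammer (c + 2) N = w * ((c + k) * (c + k + 1)) / (c * (c + 1))"
    using pochhammer_add2[of c N] nz unfolding w_def k_def
    by (metis mult_eq_0_iff nonzero_mult_div_cancel_left)
  \<comment> \<open>Raising n by one shifts \<open>c\<close> by 2, which brings in c(c+1) = 4 E n;
    this is the source of \<open>E n\<close> in \<open>F1\<close>.\<close>
  hence w2: "pochhammer (c + 2) (Suc N) = w * (c + k) * (c + k + 1) * (c + k + 2) / (4 * E n)"
    unfolding cc[symmetric] pochhammer_Suc by (simp add: k_def add_ac mult_ac)
  have w1: "pochhammer c (Suc N) = w * (c + k)"
    by (simp add: w_def k_def pochhammer_Suc)
  have w3: "pochhammer c (N + 2) = w * (c + k) * (c + k + 1)"
    by (simp add: w_def k_def pochhammer_Suc add_ac)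
  have w4: "pochhammer c (Suc N + 2) = w * (c + k) * (c + k + 1) * (c + k + 2)"
    by (simp add: w_def k_def pochhammer_Suc add_ac)
  have v1: "pochhammer (- m) (Suc N) = v * (k - m)"
    by (simp add: v_def k_def pochhammer_Suc)
  \<comment> \<open>Splitting off the first factor instead of the last reaches (-n)_N without a
    singular division.\<close>
  have v2: "pochhammer (- of_nat (Suc n)) (Suc N) = - (m + 1) * v"
    by (simp add: v_def m_def pochhammer_rec)
  have s1: "gs_coeff a b (Suc N) = gs_coeff a b N * T / ((k + 1) * (A * B))"
    unfolding gs_coeff_Suc by (simp add: T_def A_def B_def k_def add_ac)
  have c2: "2 * a + 2 * of_nat (Suc n) + 1 = c + 2" by (simp add: c_def)
  have kS: "(of_nat (Suc N) :: complex) = k + 1" by (simp add: k_def)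
  have f: "2*a + 3 * (k + 1) = 2*a + 3*k + 3" by simp
  have T': "(2*a + (k + 1)) * (2*b + (k + 1)) * (1 - 2*b + (k + 1)) = T'"
    by (simp add: T'_def add_ac)
  have F1: "gs_term a b (Suc n) (Suc N)
      = E n * K * (- (2*a + 3*k + 3) * (m + 1)) / ((k+1) * A * B * (c+k) * (c+k+1) * (c+k+2))"
    unfolding gs_term_def v2 c2 w2 s1 kS K_def f by (simp add: mult_ac del: minus_add_distrib distrib_left_numeral distrib_right_numeral)
  have F0: "gs_term a b n (Suc N)
      = K * (2*a + 3*k + 3) * (k - m) / (4 * (k+1) * A * B * (c+k))"
    unfolding gs_term_def c_def[symmetric] unfolding m_def[symmetric] v1 w1 s1 kS K_def f
    by (simp add: mult_ac del: distrib_left_numeral distrib_right_numeral)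
  have H1: "gs_cert a b n (Suc N)
      = K * T' * (k - m) / (4 * (k+1) * A * B * (c+k) * (c+k+1) * (c+k+2))"
    unfolding gs_cert_def c_def[symmetric] unfolding m_def[symmetric] v1 w4 s1 kS K_def T'
    by (simp add: mult_ac del: distrib_left_numeral distrib_right_numeral)
  have H0: "gs_cert a b n N = K / ((c+k) * (c+k+1))"
    unfolding gs_cert_def c_def[symmetric] unfolding m_def[symmetric] v_def[symmetric] w3 k_def[symmetric]
      K_def T_def
    by (simp add: field_simps)
  \<comment> \<open>Once \<open>Q\<close> is split off, the four cofactors are polynomials related
    by \<open>gs_WZ_polynomial\<close>.\<close>
  define Q where "Q = E n * K / (4 * (k+1) * A * B * (c+k) * (c+k+1) * (c+k+2))"
  have "D n * gs_term a b (Suc n) (Suc N) = Q * (- (2*a + 3*k + 3) * (4 * (m + 1) * D n))"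
    unfolding F1 Q_def
    by (simp add: mult_ac del: minus_add_distrib distrib_left_numeral distrib_right_numeral)
  moreover have "E n * gs_term a b n (Suc N)
      = Q * ((2*a + 3*k + 3) * ((k - m) * (c + k + 1) * (c + k + 2)))"
    unfolding F0 Q_def using nz
    by (simp add: mult_ac del: minus_add_distrib distrib_left_numeral distrib_right_numeral)
  moreover have "E n * gs_cert a b n (Suc N) = Q * (T' * (k - m))"
    unfolding H1 Q_def
    by (simp add: mult_ac del: minus_add_distrib distrib_left_numeral distrib_right_numeral)
  moreover have "E n * gs_cert a b n N = Q * (4 * (k + 1) * A * B * (c + k + 2))"
    unfolding H0 Q_def using nz k0 A0 B0
    by (simp add: mult_ac del: minus_add_distrib distrib_left_numeral distrib_right_numeral)
  moreover have "- (2*a + 3*k + 3) * (4 * (m + 1) * D n)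
        - (2*a + 3*k + 3) * ((k - m) * (c + k + 1) * (c + k + 2))
        = T' * (k - m) - 4 * (k + 1) * A * B * (c + k + 2)"
    using gs_WZ_polynomial[of a k m b]
    unfolding D_def T'_def A_def B_def c_def m_def[symmetric] by (simp add: algebra_simps)
  ultimately have "D n * gs_term a b (Suc n) (Suc N) - E n * gs_term a b n (Suc N)
      = E n * gs_cert a b n (Suc N) - E n * gs_cert a b n N"
    by (metis (no_types, lifting) right_diff_distrib)
  thus ?case using Suc.IH by (simp add: algebra_simps)
qed

text \<open>Taking the partial sums up to n + 1, the factor (-n)_{n+1} = 0 kills both the
  certificate and the last term for n, which leaves a first-order recurrence. The factor 2a is the
  price of using 2a + 3k in the summand.\<close>

theorem gessel_stanton_terminating:
  assumes a: "Re a > -1/2" and ab: "a - b + 1 \<notin> \<int>\<^sub>\<le>\<^sub>0" "a + b + 1/2 \<notin> \<int>\<^sub>\<le>\<^sub>0"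
  shows "(\<Sum>k\<le>n. gs_term a b n k)
    = 2 * a * (pochhammer (a + 1/2) n * pochhammer (a + 1) n
        / (pochhammer (a + b + 1/2) n * pochhammer (a - b + 1) n))"
proof (induction n)
  case 0
  show ?case by (simp add: gs_term_def gs_coeff_def)
next
  case (Suc n)
  have "gs_cert a b n (Suc n) = 0" "gs_term a b n (Suc n) = 0"
    by (simp_all add: gs_cert_def gs_term_def pochhammer_of_nat_eq_0_iff)
  with gs_WZ_sum[OF assms, of n "Suc n"]
  have "(a + b + 1/2 + of_nat n) * (a - b + 1 + of_nat n) * (\<Sum>k\<le>Suc n. gs_term a b (Suc n) k)
     = (a + 1/2 + of_nat n) * (a + 1 + of_nat n) * (\<Sum>k\<le>n. gs_term a b n k)"
    by simp
  moreover have "a + b + 1/2 + of_nat n \<noteq> 0" "a - b + 1 + of_nat n \<noteq> 0"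
    using ab by (simp_all only: add_of_nat_nonzero not_False_eq_True)
  ultimately have "(\<Sum>k\<le>Suc n. gs_term a b (Suc n) k)
     = (a + 1/2 + of_nat n) * (a + 1 + of_nat n) * (\<Sum>k\<le>n. gs_term a b n k)
        / ((a + b + 1/2 + of_nat n) * (a - b + 1 + of_nat n))"
    by (metis mult_eq_0_iff nonzero_mult_div_cancel_left)
  thus ?case unfolding Suc.IH pochhammer_Suc by (simp only: times_divide_eq_right divide_divide_eq_left mult_ac)
qed

section \<open>Passage to the limit under the sum\<close>

lemma tendsto_affine_quotient:
  fixes z w u v :: complex
  assumes "v \<noteq> 0"
  shows "(\<lambda>n. (z + of_nat n * u) / (w + of_nat n * v)) \<longlonglongrightarrow> u / v"
proof -
  have "(\<lambda>n. (z * inverse (of_nat n) + u) / (w * inverse (of_nat n) + v)) \<longlonglongrightarrow> (z * 0 + u) / (w * 0 + v)"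
    by (intro tendsto_intros lim_inverse_n) (use assms in simp)
  hence "(\<lambda>n. (z * inverse (of_nat n) + u) / (w * inverse (of_nat n) + v)) \<longlonglongrightarrow> u / v"
    by simp
  moreover have "eventually (\<lambda>n. (z * inverse (of_nat n) + u) / (w * inverse (of_nat n) + v)
      = (z + of_nat n * u) / (w + of_nat n * v)) sequentially"
    using eventually_gt_at_top[of 0]
  proof eventually_elim
    case (elim n)
    hence "z * inverse (of_nat n) + u = (z + of_nat n * u) / of_nat n"
      "w * inverse (of_nat n) + v = (w + of_nat n * v) / of_nat n"
      by (simp_all add: field_simps)
    thus ?case using elim by simp
  qed
  ultimately show ?thesis
    by (rule Lim_transform_eventually)
qed

text \<open>The dominating series for Tannery's theorem: its term ratio tends to 1/8, hence is
  eventually below 1/2.\<close>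

lemma summable_gs_coeff:
  assumes a: "Re a > -1/2"
  shows "summable (\<lambda>k. norm (gs_coeff a b k * (2*a + 3 * of_nat k) / 8 ^ k))"
proof -
  define f where "f k = gs_coeff a b k * (2*a + 3 * of_nat k) / 8 ^ k" for k
  \<comment> \<open>The redundant \<open>* 1\<close> gives each quotient the shape required by
    \<open>tendsto_affine_quotient\<close>.\<close>
  define r where "r k = ((2*a + of_nat k * 1) / (1 + of_nat k * 1))
     * ((2*b + of_nat k * 1) / (a - b + 1 + of_nat k * 1))
     * ((1 - 2*b + of_nat k * 1) / (a + b + 1/2 + of_nat k * 1))
     * ((2*a + 3 + of_nat k * 3) / (2*a + of_nat k * 3)) * (1/8)" for k
  have "r \<longlonglongrightarrow> (1/1) * (1/1) * (1/1) * (3/3) * (1/8)"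
    unfolding r_def by (intro tendsto_mult tendsto_affine_quotient tendsto_const) simp_all
  hence "(\<lambda>k. norm (r k)) \<longlonglongrightarrow> norm ((1/1) * (1/1) * (1/1) * (3/3) * (1/8) :: complex)"
    by (rule tendsto_norm)
  hence ev: "eventually (\<lambda>k. norm (r k) < 1/2) sequentially"
    by (rule order_tendstoD) simp
  \<comment> \<open>The ratio cancels 2a + 3k, which may vanish at k = 0 but has positive real part
    for k > 0.\<close>
  have step: "f (Suc k) = r k * f k" if "k > 0" for k
  proof -
    have "Re (2*a + 3 * of_nat k) > 0" using a that by simp
    hence nz: "2*a + 3 * of_nat k \<noteq> 0" by (metis less_irrefl zero_complex.sel(1))
    have "f (Suc k) = gs_coeff a b (Suc k) * (2*a + 3 + of_nat k * 3) / (8 * 8 ^ k)"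
      by (simp add: f_def algebra_simps)
    also have "\<dots> = r k * f k"
      unfolding f_def r_def gs_coeff_Suc using nz by (simp add: mult_ac)
    finally show ?thesis .
  qed
  have "eventually (\<lambda>k. norm (f (Suc k)) \<le> 1/2 * norm (f k)) sequentially"
    using ev eventually_gt_at_top[of 0]
  proof eventually_elim
    case (elim k)
    hence "norm (r k) * norm (f k) \<le> 1/2 * norm (f k)"
      by (intro mult_right_mono) auto
    thus ?case using step elim by (simp add: norm_mult)
  qed
  then obtain N where "\<And>k. k \<ge> N \<Longrightarrow> norm (f (Suc k)) \<le> 1/2 * norm (f k)"
    by (auto simp: eventually_at_top_linorder)
  hence "summable (\<lambda>k. norm (f k))"
    by (intro summable_ratio_test[of "1/2" N]) auto
  thus ?thesis by (simp add: f_def)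
qed

text \<open>For fixed k, each factor (j - n) / (2a + 2n + 1 + j) tends to -1/2; with 4^k this gives
  (-1/8)^k.\<close>

lemma tendsto_gs_term:
  "(\<lambda>n. gs_term a b n k) \<longlonglongrightarrow> gs_coeff a b k * (2*a + 3 * of_nat k) * (-1/8) ^ k"
proof -
  have "(\<lambda>n. pochhammer (- of_nat n) k / pochhammer (2*a + 2 * of_nat n + 1) k)
      \<longlonglongrightarrow> (-1/2 :: complex) ^ k"
  proof (induction k)
    case (Suc k)
    have "(\<lambda>n. pochhammer (- of_nat n) k / pochhammer (2*a + 2 * of_nat n + 1) k
        * ((of_nat k + of_nat n * (-1)) / (2*a + 1 + of_nat k + of_nat n * 2)))
      \<longlonglongrightarrow> (-1/2 :: complex) ^ k * (-1/2)"
      by (intro tendsto_mult Suc.IH tendsto_affine_quotient) simp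
    thus ?case by (simp add: pochhammer_Suc add_ac mult_ac)
  qed simp
  hence "(\<lambda>n. gs_term a b n k)
      \<longlonglongrightarrow> gs_coeff a b k * (2*a + 3 * of_nat k) * (-1/2) ^ k / 4 ^ k"
    unfolding gs_term_def by (intro tendsto_intros) simp_all
  moreover have "(-1/2) ^ k / 4 ^ k = (-1/8 :: complex) ^ k"
    by (simp flip: power_divide)
  ultimately show ?thesis by (metis times_divide_eq_right)
qed

text \<open>The bound is uniform in \<open>n\<close>: for k <= n each factor of the quotient has
  modulus at most 1/2, and for k > n the term is 0.\<close>

lemma norm_gs_term_le:
  assumes a: "Re a > -1/2"
  shows "norm (gs_term a b n k) \<le> norm (gs_coeff a b k * (2*a + 3 * of_nat k) / 8 ^ k)"
proof -
  have "norm (pochhammer (- of_nat n) k / pochhammer (2*a + 2 * of_nat n + 1) k) \<le> (1/2) ^ k"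
  proof (cases "k \<le> n")
    case True
    thus ?thesis
    proof (induction k)
      case (Suc k)
      have "2 * norm (- of_nat n + of_nat k :: complex) = 2 * (real n - real k)"
        using Suc.prems by (metis abs_minus_commute abs_of_nonneg diff_ge_0_iff_ge norm_of_real
            of_nat_le_iff of_real_diff of_real_of_nat_eq Suc_leD uminus_add_conv_diff)
      \<comment> \<open>The difference of the two sides is 2 Re a + 1 + 3k, positive by the
        hypothesis on \<open>a\<close>.\<close>
      also have "\<dots> \<le> Re (2*a + 2 * of_nat n + 1 + of_nat k)"
        using a by simp
      also have "\<dots> \<le> norm (2*a + 2 * of_nat n + 1 + of_nat k)"
        by (rule complex_Re_le_cmod)
      finally have "norm (- of_nat n + of_nat k :: complex) / norm (2*a + 2 * of_nat n + 1 + of_nat k) \<le> 1/2"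
        by (simp add: divide_simps)
      from mult_mono[OF Suc.IH this] Suc.prems show ?case
        by (simp add: pochhammer_Suc norm_mult norm_divide mult_ac)
    qed simp
  next
    case False
    hence "pochhammer (- of_nat n :: complex) k = 0"
      by (simp add: pochhammer_of_nat_eq_0_iff)
    thus ?thesis by simp
  qed
  hence "norm (gs_coeff a b k * (2*a + 3 * of_nat k)) *
     norm (pochhammer (- of_nat n) k / pochhammer (2*a + 2 * of_nat n + 1) k) / 4 ^ k
     \<le> norm (gs_coeff a b k * (2*a + 3 * of_nat k)) * (1/2) ^ k / 4 ^ k"
    by (intro divide_right_mono mult_left_mono) auto
  also have "\<dots> = norm (gs_coeff a b k * (2*a + 3 * of_nat k)) / 8 ^ k"
    by (simp add: power_one_over flip: power_mult_distrib)
  finally show ?thesis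
    by (simp only: gs_term_def norm_divide norm_mult norm_power norm_numeral)
qed

text \<open>In the Gauss product for 1/Gamma the normalising factors depend on the parameters only
  through n^s; equal parameter sums make them cancel. The product has n + 1 factors, hence the index
  shift at the end.\<close>

lemma tendsto_pochhammer_quotient:
  fixes x y u v :: complex
  assumes "x + y = u + v" and uv: "u \<notin> \<int>\<^sub>\<le>\<^sub>0" "v \<notin> \<int>\<^sub>\<le>\<^sub>0"
  shows "(\<lambda>n. pochhammer x n * pochhammer y n / (pochhammer u n * pochhammer v n))
     \<longlonglongrightarrow> rGamma x * rGamma y / (rGamma u * rGamma v)"
proof -
  have "(\<lambda>n. rGamma_series x n * rGamma_series y n / (rGamma_series u n * rGamma_series v n))
     \<longlonglongrightarrow> rGamma x * rGamma y / (rGamma u * rGamma v)"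
    by (intro tendsto_intros) (use uv in \<open>simp add: rGamma_eq_zero_iff\<close>)
  moreover have "rGamma_series x n * rGamma_series y n / (rGamma_series u n * rGamma_series v n)
     = pochhammer x (Suc n) * pochhammer y (Suc n) / (pochhammer u (Suc n) * pochhammer v (Suc n))" for n
  proof -
    let ?L = "complex_of_real (ln (of_nat n))"
    have *: "rGamma_series s n * rGamma_series t n
       = pochhammer s (Suc n) * pochhammer t (Suc n) / (fact n ^ 2 * exp ((s + t) * ?L))" for s t
      by (simp add: rGamma_series_def exp_add ring_distribs power2_eq_square mult_ac)
    show ?thesis unfolding * assms(1) by simp
  qed
  ultimately have "(\<lambda>n. pochhammer x (Suc n) * pochhammer y (Suc n)
      / (pochhammer u (Suc n) * pochhammer v (Suc n)))
      \<longlonglongrightarrow> rGamma x * rGamma y / (rGamma u * rGamma v)"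
    by simp
  thus ?thesis by (rule LIMSEQ_imp_Suc)
qed

text \<open>For each n the series is the finite sum up to n, with known value. Tannery's theorem
  gives the limit of the sums; the closed form converges because both parameter pairs sum to 2a +
  3/2.\<close>

theorem gessel_stanton_nonterminating:
  assumes a: "Re a > -1/2" and ab: "a - b + 1 \<notin> \<int>\<^sub>\<le>\<^sub>0" "a + b + 1/2 \<notin> \<int>\<^sub>\<le>\<^sub>0"
  shows "(\<lambda>k. gs_coeff a b k * (2*a + 3 * of_nat k) * (-1/8) ^ k)
    sums (2 * a * (Gamma (a + b + 1/2) * Gamma (a - b + 1) / (Gamma (a + 1/2) * Gamma (a + 1))))"
    (is "?f sums ?S")
proof -
  let ?M = "\<lambda>k. norm (gs_coeff a b k * (2*a + 3 * of_nat k) / 8 ^ k)"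
  have "eventually (\<lambda>n. summable (\<lambda>k. norm (gs_term a b n k))) sequentially \<and>
      summable (\<lambda>k. norm (?f k)) \<and>
      (\<lambda>n. suminf (\<lambda>k. gs_term a b n k)) \<longlonglongrightarrow> suminf ?f"
  proof (rule tannerys_theorem)
    show "eventually (\<lambda>(k, n). norm (gs_term a b n k) \<le> ?M k) (sequentially \<times>\<^sub>F sequentially)"
      using norm_gs_term_le[OF a] by (intro always_eventually) auto
  qed (use tendsto_gs_term summable_gs_coeff[OF a] in auto)
  hence summ: "summable ?f" and lim: "(\<lambda>n. suminf (\<lambda>k. gs_term a b n k)) \<longlonglongrightarrow> suminf ?f"
    by (auto intro: summable_norm_cancel)
  have "suminf (\<lambda>k. gs_term a b n k) = 2 * a * (pochhammer (a + 1/2) n * pochhammer (a + 1) n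
        / (pochhammer (a + b + 1/2) n * pochhammer (a - b + 1) n))" for n
  proof -
    have "suminf (\<lambda>k. gs_term a b n k) = (\<Sum>k\<le>n. gs_term a b n k)"
      by (rule suminf_finite) (auto simp: gs_term_def pochhammer_of_nat_eq_0_iff)
    thus ?thesis by (simp add: gessel_stanton_terminating[OF assms])
  qed
  moreover have "(\<lambda>n. 2 * a * (pochhammer (a + 1/2) n * pochhammer (a + 1) n
        / (pochhammer (a + b + 1/2) n * pochhammer (a - b + 1) n)))
      \<longlonglongrightarrow> 2 * a * (rGamma (a + 1/2) * rGamma (a + 1) / (rGamma (a + b + 1/2) * rGamma (a - b + 1)))"
    by (intro tendsto_mult tendsto_const tendsto_pochhammer_quotient ab) simp
  ultimately have "suminf ?f = 2 * a * (rGamma (a + 1/2) * rGamma (a + 1)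
      / (rGamma (a + b + 1/2) * rGamma (a - b + 1)))"
    using lim by (simp add: LIMSEQ_unique)
  also have "\<dots> = ?S"
    by (simp add: rGamma_inverse_Gamma field_simps)
  finally show ?thesis using summ by (simp add: sums_iff)
qed

section \<open>Evaluation of the Gamma constant\<close>

text \<open>Reflection turns Gamma(2b) Gamma(1-2b) into -pi, duplication cancels 2a Gamma(2a), and
  Gamma(3/2)^2 Gamma(-1/2) = -pi^(3/2)/2.\<close>

lemma gs_Gamma_constant:
  fixes a b :: complex
  assumes a: "Re a > 0" and b: "sin (of_real pi * (2*b)) = -1"
  shows "2 * (Gamma (2*a) * Gamma (2*b) * Gamma (1 - 2*b)) / (Gamma (3/2) ^ 2 * Gamma (-1/2))
      * (2 * a / (Gamma (a + 1/2) * Gamma (a + 1))) = 4 * exp (2 * a * of_real (ln 2)) / of_real pi"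
proof -
  have pi: "complex_of_real (sqrt pi) ^ 2 = of_real pi"
    by (simp flip: of_real_power)
  have "Gamma (1/2 + 1 :: complex) = 1/2 * Gamma (1/2)"
    by (rule Gamma_plus1, rule Re_pos_not_nonpos_Int) simp
  hence g32: "Gamma (3/2 :: complex) = of_real (sqrt pi) / 2"
    by (simp add: Gamma_one_half_complex)
  have "(-1/2 :: complex) \<notin> \<int>\<^sub>\<le>\<^sub>0"
    using fraction_not_in_Ints[of 2 "-1", where 'a = complex] nonpos_Ints_Int by fastforce
  hence "Gamma (-1/2 + 1 :: complex) = -1/2 * Gamma (-1/2)"
    by (rule Gamma_plus1)
  hence gm: "Gamma (-1/2 :: complex) = - 2 * of_real (sqrt pi)"
    by (simp add: Gamma_one_half_complex)
  have refl: "Gamma (2*b) * Gamma (1 - 2*b) = - of_real pi"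
    using Gamma_reflection_complex[of "2*b"] b by simp
  have a1: "2 * a \<notin> \<int>\<^sub>\<le>\<^sub>0" "a + 1/2 \<notin> \<int>\<^sub>\<le>\<^sub>0" "a + 1/2 + 1/2 \<notin> \<int>\<^sub>\<le>\<^sub>0"
    using a by (auto intro!: Re_pos_not_nonpos_Int)
  have "Gamma (a + 1/2) * Gamma (a + 1)
      = exp (- (2 * a * of_real (ln 2))) * of_real (sqrt pi) * Gamma (2 * a + 1)"
    using Gamma_legendre_duplication[OF a1(2,3)] by (simp add: algebra_simps)
  also have "Gamma (2 * a + 1) = 2 * a * Gamma (2 * a)"
    by (rule Gamma_plus1[OF a1(1)])
  finally have dup: "Gamma (a + 1/2) * Gamma (a + 1)
      = of_real (sqrt pi) * (2 * a * Gamma (2 * a)) / exp (2 * a * of_real (ln 2))"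
    by (simp add: exp_minus field_simps)
  have nz: "Gamma (2*a) \<noteq> 0" "a \<noteq> 0" "complex_of_real (sqrt pi) \<noteq> 0"
    using a1 a by (auto simp: Gamma_eq_zero_iff)
  show ?thesis
    unfolding dup g32 gm mult.assoc[of "Gamma (2*a)"] refl pi[symmetric]
    using nz by (simp add: field_simps power2_eq_square)
qed

section \<open>Specialization to integer parameters\<close>

theorem theorem4:
  fixes p q :: int
  assumes "min (p + q + 1) (p - q) \<ge> 0"
  shows "(\<lambda>k::nat.
            shifted_fact (3/2) (int k + 2 * p) * shifted_fact (3/2) (int k + 2 * q)
              * shifted_fact (- 1/2) (int k - 2 * q)
            / (fact k * fact (nat (int k + p + q + 1)) * fact (nat (int k + p - q)))
            * ((6 * of_nat k + 4 * of_int p + 3) / (- 8) ^ k))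
         sums (4 powi (p + 2) / (of_real (sqrt 2) * of_real pi))"
proof -
  \<comment> \<open>Chosen so that 2a = 3/2 + 2p, 2b = 3/2 + 2q and 1 - 2b = -1/2 - 2q are the bases
    of the three shifted factorials at k = 0.\<close>
  define a where "a = complex_of_int p + 3/4"
  define b where "b = complex_of_int q + 3/4"
  \<comment> \<open>Adding the two bounds gives 2p + 1 >= 0, and \<open>p\<close> is an
    integer.\<close>
  have p0: "p \<ge> 0" using assms by linarith
  have Rea: "Re a > 0" using p0 by (simp add: a_def)
  have h: "p - q \<ge> 0" "p + q + 1 \<ge> 0" using assms by auto
  obtain i where i: "p - q = int i" using h(1) nonneg_int_cases by blast
  obtain j where j: "p + q + 1 = int j" using h(2) nonneg_int_cases by blast
  \<comment> \<open>The lower parameters become positive integers, so their Pochhammer symbols are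
    quotients of factorials.\<close>
  have A: "a - b + 1 = 1 + of_nat i"
    using arg_cong[OF i, of complex_of_int] by (simp add: a_def b_def)
  have B: "a + b + 1/2 = 1 + of_nat j"
    using arg_cong[OF j, of complex_of_int] by (simp add: a_def b_def algebra_simps)
  have ab: "a - b + 1 \<notin> \<int>\<^sub>\<le>\<^sub>0" "a + b + 1/2 \<notin> \<int>\<^sub>\<le>\<^sub>0"
    unfolding A B by (intro Re_pos_not_nonpos_Int; simp)+
  have a2: "2*a \<notin> \<int>\<^sub>\<le>\<^sub>0" using Rea by (intro Re_pos_not_nonpos_Int) simp
  have sin2b: "sin (of_real pi * (2*b)) = -1"
  proof -
    have "sin (pi * (2 * (of_int q + 3/4))) = sin (3/2 * pi + 2 * pi * of_int q)"
      by (simp add: algebra_simps)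
    also have "\<dots> = sin (3/2 * pi)"
      unfolding sin_add sin_int_2pin cos_int_2pin by simp
    also have "\<dots> = -1" by (rule sin_3over2_pi)
    finally have "complex_of_real (sin (pi * (2 * (of_int q + 3/4)))) = -1" by simp
    moreover have "complex_of_real (pi * (2 * (of_int q + 3/4))) = of_real pi * (2*b)"
      by (simp add: b_def)
    ultimately show ?thesis by (metis sin_of_real)
  qed
  have b2: "2*b \<notin> \<int>\<^sub>\<le>\<^sub>0" "1 - 2*b \<notin> \<int>\<^sub>\<le>\<^sub>0"
  proof -
    \<comment> \<open>By reflection the product is -pi, whereas \<open>Gamma\<close> is 0 at its
      poles; so neither argument is a pole.\<close>
    have "Gamma (2*b) * Gamma (1 - 2*b) \<noteq> 0"
      using Gamma_reflection_complex[of "2*b"] sin2b by simp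
    thus "2*b \<notin> \<int>\<^sub>\<le>\<^sub>0" "1 - 2*b \<notin> \<int>\<^sub>\<le>\<^sub>0" by (auto simp: Gamma_eq_zero_iff)
  qed
  define G where "G = Gamma (a + b + 1/2) * Gamma (a - b + 1)"
  \<comment> \<open>\<open>C\<close> collects the Gamma factors free of k; its 2 comes from 6k + 4p
    + 3 = 2(2a + 3k). \<open>G\<close> comes from the factorials and cancels against the value of
    the sum.\<close>
  define C where "C = 2 * (Gamma (2*a) * Gamma (2*b) * Gamma (1 - 2*b))
     / (Gamma (3/2) ^ 2 * Gamma (-1/2))"
  have G0: "G \<noteq> 0" using ab by (simp add: G_def Gamma_eq_zero_iff)
  have "shifted_fact (3/2) (int k + 2 * p) * shifted_fact (3/2) (int k + 2 * q)
              * shifted_fact (- 1/2) (int k - 2 * q)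
            / (fact k * fact (nat (int k + p + q + 1)) * fact (nat (int k + p - q)))
            * ((6 * of_nat k + 4 * of_int p + 3) / (- 8) ^ k)
       = C / G * (gs_coeff a b k * (2*a + 3 * of_nat k) * (-1/8) ^ k)" for k
  proof -
    have P: "Gamma (z + of_nat k) = pochhammer z k * Gamma z" if "z \<notin> \<int>\<^sub>\<le>\<^sub>0" for z :: complex
      using pochhammer_Gamma[OF that, of k] that by (simp add: Gamma_eq_zero_iff)
    have "3/2 + of_int (int k + 2 * p) = 2*a + of_nat k" by (simp add: a_def)
    hence 1: "shifted_fact (3/2) (int k + 2 * p) = pochhammer (2*a) k * Gamma (2*a) / Gamma (3/2)"
      by (simp only: shifted_fact_def P[OF a2])
    have "3/2 + of_int (int k + 2 * q) = 2*b + of_nat k" by (simp add: b_def)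
    hence 2: "shifted_fact (3/2) (int k + 2 * q) = pochhammer (2*b) k * Gamma (2*b) / Gamma (3/2)"
      by (simp only: shifted_fact_def P[OF b2(1)])
    have "-1/2 + of_int (int k - 2 * q) = 1 - 2*b + of_nat k" by (simp add: b_def)
    hence 3: "shifted_fact (-1/2) (int k - 2 * q)
        = pochhammer (1 - 2*b) k * Gamma (1 - 2*b) / Gamma (-1/2)"
      by (simp only: shifted_fact_def P[OF b2(2)])
    have "nat (int k + p + q + 1) = j + k" using j by linarith
    hence 4: "fact (nat (int k + p + q + 1)) = pochhammer (a + b + 1/2) k * Gamma (a + b + 1/2)"
      using P[OF ab(2)] Gamma_fact[of "j + k", where 'a = complex] unfolding B by (simp add: add_ac)
    have "nat (int k + p - q) = i + k" using i by linarith
    hence 5: "fact (nat (int k + p - q)) = pochhammer (a - b + 1) k * Gamma (a - b + 1)"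
      using P[OF ab(1)] Gamma_fact[of "i + k", where 'a = complex] unfolding A by (simp add: add_ac)
    have 6: "(6 * of_nat k + 4 * of_int p + 3) / (- 8) ^ k = 2 * (2*a + 3 * of_nat k) * (-1/8) ^ k"
      proof -
      have "(-1/8) ^ k = 1 / (- 8 :: complex) ^ k"
        by (metis divide_minus_left divide_minus_right power_one_over)
      thus ?thesis by (simp add: a_def algebra_simps add_divide_distrib)
    qed
    show ?thesis
      unfolding 1 2 3 4 5 6 C_def G_def gs_coeff_def by (simp add: power2_eq_square mult_ac)
  qed
  moreover have "(\<lambda>k. C / G * (gs_coeff a b k * (2*a + 3 * of_nat k) * (-1/8) ^ k))
    sums (C / G * (2 * a * (G / (Gamma (a + 1/2) * Gamma (a + 1)))))"
    unfolding G_def using Rea ab by (intro sums_mult gessel_stanton_nonterminating) auto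
  moreover have "C / G * (2 * a * (G / (Gamma (a + 1/2) * Gamma (a + 1))))
     = 4 * exp (2 * a * of_real (ln 2)) / of_real pi"
    using gs_Gamma_constant[OF Rea sin2b] G0 unfolding C_def by simp
  \<comment> \<open>This is 2^(2a) = 2^(2p + 3/2) = 2^(2p + 2) / sqrt 2.\<close>
  moreover have "exp (2 * a * of_real (ln 2)) = 4 powi (p + 1) / of_real (sqrt 2)"
  proof -
    obtain m where m: "p = int m" using p0 nonneg_int_cases by blast
    have "2 * ln 2 * real m + 3/2 * ln 2 = real m * ln 4 + ln 4 - ln (sqrt 2)"
      by (simp add: ln_sqrt ln_realpow[of 2 2, simplified])
    hence "exp (2 * ln 2 * real m + 3/2 * ln 2) = 4 ^ m * 4 / sqrt 2"
      by (simp add: exp_add exp_diff exp_of_nat_mult)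
    hence "complex_of_real (exp (2 * ln 2 * real m + 3/2 * ln 2)) = 4 ^ m * 4 / of_real (sqrt 2)"
      by simp
    moreover have "2 * a * of_real (ln 2) = complex_of_real (2 * ln 2 * real m + 3/2 * ln 2)"
      by (simp add: a_def m algebra_simps)
    moreover have "(4 :: complex) powi (p + 1) = 4 ^ m * 4"
      by (simp add: m power_int_add)
    ultimately show ?thesis by (simp only: exp_of_real)
  qed
  moreover have "(4 :: complex) powi (p + 2) = 4 * 4 powi (p + 1)"
    by (simp add: power_int_add)
  ultimately show ?thesis by simp
qed

end
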